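(* For all integers $n,m\ge1$ and every output-restricted deque sequence $S$ of length $m$ on $[n]$, the point set $P$ produced by \textsc{Greedy} on $S$ satisfies $|P|\le 24m+12n$.
   Context: Update sequences. An update sequence of length $m$ on $[n]=\{1,\dots,n\}$ is $S=\langle (s_1,\mathrm{op}_1),\dots,(s_m,\mathrm{op}_m)\rangle$ with $s_t\in[n]$ and $\mathrm{op}_t\in\{\mathtt{access},\mathtt{insert},\mathtt{delete}\}$. Standing assumptions: for each element, its insertions and deletions alternate along $S$, and every $x\in[n]$ occurs in $S$. Let $K_0$ be the set of elements whose first operation in $S$ is not an insertion, and $K_t=K_{t-1}\cup\{s_t\}$ if $\mathrm{op}_t=\mathtt{insert}$, $K_t=K_{t-1}\setminus\{s_t\}$ if $\mathrm{op}_t=\mathtt{delete}$, $K_t=K_{t-1}$ otherwise. $S$ is a deque sequence if it has no access operations, every insertion at time $t$ has $s_t=\min K_t$ or $s_t=\max K_t$, and every deletion at time $t$ has $s_t=\min K_{t-1}$ or $s_t=\max K_{t-1}$. It is output-restricted if moreover every deletion at time $t$ has $s_t=\min K_{t-1}$. Geometric view. Points are $p=(p_x,p_t)\in[n]\times[m]$. Let $I=\{(s_t,t):\mathrm{op}_t=\mathtt{insert}\}$, $D=\{(s_t,t):\mathrm{op}_t=\mathtt{delete}\}$, $A=\{(s_t,t):\mathrm{op}_t=\mathtt{access}\}$, $U=I\cup D$. For a point $p$, let $p'$ (resp. $p''$) be the point of $U$ in column $p_x$ with the largest time $<p_t$ (resp. smallest time $>p_t$), if it exists. $p$ is valid iff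 either (1) $p\notin U$, $p'\in I$ or nonexistent, and $p''\in D$ or nonexistent; or (2) $p\in I$, $p'\in D$ or nonexistent, and $p''\in D$ or nonexistent; or (3) $p\in D$, $p'\in I$ or nonexistent, and $p''\in I$ or nonexistent. For a valid point $p$, its active time is the maximal interval of consecutive integers containing $p_t$ such that $(p_x,t)$ is valid for every $t$ in it. Two points $p,q$ with $p_t\le q_t$ form an active pair if every time in $[p_t,q_t]$ lies in the active times of both. $\mathrm{pred}(p)$ is the point $(x',p_t)$ with $x'$ the largest $x'<p_x$ such that $(x',p_t)$ is valid (if any); $\mathrm{succ}(p)$ is symmetric. $\square_{pq}$ is the closed axis-parallel rectangle with opposite corners $p,q$. \textsc{Greedy}. It processes $t=1,\dots,m$ and builds $P$ row by row; $P_{<t}$ denotes the points placed in rows $1,\dots,t-1$. For a valid point $u$ in row $t$, $\mathrm{stair}(u)=\{u\}\cup\{q\in P_{<t}: u,q\text{ form an active pair and }\square_{uq}\cap P_{<t}=\{q\}\}$. Let $p=(s_t,t)$. If $\mathrm{op}_t=\mathtt{access}$, or $p\in U$ and not both $\mathrm{pred}(p),\mathrm{succ}(p)$ exist, row $t$ of $P$ is $\{(q_x,t):q\in\mathrm{stair}(p)\}$; if $p\in U$ and both exist, row $t$ is the smaller (ties arbitrary) of $\{(q_x,t):q\in\mathrm{stair}(p)\cup\mathrm{stair}(\mathrm{pred}(p))\}$ and $\{(q_x,t):q\in\mathrm{stair}(p)\cup\mathrm{stair}(\mathrm{succ}(p))\}$. The cost of \textsc{Greedy} on $S$ is $|P|$.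 *)

theory Defs
  imports Main
begin

datatype operation = Access | Insert | Delete

text \<open>Times run from 1 to \<open>length S\<close>, so the operation at time \<open>t\<close> is the list entry \<open>t - 1\<close>.\<close>

type_synonym update_list = "(nat \<times> operation) list"

definition key_at :: "update_list \<Rightarrow> nat \<Rightarrow> nat" where
  "key_at S t = fst (S ! (t - 1))"

definition op_at :: "update_list \<Rightarrow> nat \<Rightarrow> operation" where
  "op_at S t = snd (S ! (t - 1))"

text \<open>Points are pairs (key, time).\<close>

type_synonym point = "nat \<times> nat"

definition pts :: "update_list \<Rightarrow> operation \<Rightarrow> point set" where
  "pts S c = {(key_at S t, t) | t. t \<in> {1..length S} \<and> op_at S t = c}"

definition upd_pts :: "update_list \<Rightarrow> point set" where
  "upd_pts S = pts S Insert \<union> pts S Delete"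


subsection \<open>Update sequences and deque sequences\<close>

definition alternating :: "update_list \<Rightarrow> bool" where
  "alternating S \<longleftrightarrow>
     (\<forall>x s t. (x, s) \<in> upd_pts S \<and> (x, t) \<in> upd_pts S \<and> s < t \<and>
        (\<forall>r. s < r \<and> r < t \<longrightarrow> (x, r) \<notin> upd_pts S) \<longrightarrow> op_at S s \<noteq> op_at S t)"

definition update_seq :: "nat \<Rightarrow> update_list \<Rightarrow> bool" where
  "update_seq n S \<longleftrightarrow>
     (\<forall>t\<in>{1..length S}. key_at S t \<in> {1..n}) \<and>
     alternating S \<and>
     (\<forall>x\<in>{1..n}. \<exists>t\<in>{1..length S}. key_at S t = x)"

primrec keys :: "nat \<Rightarrow> update_list \<Rightarrow> nat \<Rightarrow> nat set" where
  "keys n S 0 =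
     {x \<in> {1..n}. \<exists>t\<in>{1..length S}. key_at S t = x \<and> op_at S t \<noteq> Insert \<and>
        (\<forall>s\<in>{1..<t}. key_at S s \<noteq> x)}"
| "keys n S (Suc t) =
     (case op_at S (Suc t) of
        Insert \<Rightarrow> keys n S t \<union> {key_at S (Suc t)}
      | Delete \<Rightarrow> keys n S t - {key_at S (Suc t)}
      | Access \<Rightarrow> keys n S t)"

definition deque_seq :: "nat \<Rightarrow> update_list \<Rightarrow> bool" where
  "deque_seq n S \<longleftrightarrow>
     update_seq n S \<and>
     (\<forall>t\<in>{1..length S}. op_at S t \<noteq> Access) \<and>
     (\<forall>t\<in>{1..length S}. op_at S t = Insert \<longrightarrow>
        key_at S t = Min (keys n S t) \<or> key_at S t = Max (keys n S t)) \<and>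
     (\<forall>t\<in>{1..length S}. op_at S t = Delete \<longrightarrow>
        key_at S t = Min (keys n S (t - 1)) \<or> key_at S t = Max (keys n S (t - 1)))"

definition output_restricted_deque_seq :: "nat \<Rightarrow> update_list \<Rightarrow> bool" where
  "output_restricted_deque_seq n S \<longleftrightarrow>
     deque_seq n S \<and>
     (\<forall>t\<in>{1..length S}. op_at S t = Delete \<longrightarrow> key_at S t = Min (keys n S (t - 1)))"


subsection \<open>Valid points, active times and neighbours\<close>

definition prev_upd :: "update_list \<Rightarrow> point \<Rightarrow> point option" where
  "prev_upd S p =
     (let T = {t. (fst p, t) \<in> upd_pts S \<and> t < snd p}
      in if T = {} then None else Some (fst p, Max T))"

definition next_upd :: "update_list \<Rightarrow> point \<Rightarrow> point option" where
  "next_upd S p =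
     (let T = {t. (fst p, t) \<in> upd_pts S \<and> snd p < t}
      in if T = {} then None else Some (fst p, Min T))"

definition none_or_in :: "point option \<Rightarrow> point set \<Rightarrow> bool" where
  "none_or_in q Q \<longleftrightarrow> (case q of None \<Rightarrow> True | Some r \<Rightarrow> r \<in> Q)"

definition valid :: "nat \<Rightarrow> update_list \<Rightarrow> point \<Rightarrow> bool" where
  "valid n S p \<longleftrightarrow>
     p \<in> {1..n} \<times> {1..length S} \<and>
     (p \<notin> upd_pts S \<and>
        none_or_in (prev_upd S p) (pts S Insert) \<and> none_or_in (next_upd S p) (pts S Delete)
      \<or> p \<in> pts S Insert \<and>
        none_or_in (prev_upd S p) (pts S Delete) \<and> none_or_in (next_upd S p) (pts S Delete)
      \<or> p \<in> pts S Delete \<and>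
        none_or_in (prev_upd S p) (pts S Insert) \<and> none_or_in (next_upd S p) (pts S Insert))"

text \<open>The maximal interval is obtained as the union of all intervals of valid times around
  the point; it is empty if the point itself is not valid.\<close>

definition active_time :: "nat \<Rightarrow> update_list \<Rightarrow> point \<Rightarrow> nat set" where
  "active_time n S p =
     \<Union> {{a..b} | a b. snd p \<in> {a..b} \<and> (\<forall>t\<in>{a..b}. valid n S (fst p, t))}"

definition active_pair :: "nat \<Rightarrow> update_list \<Rightarrow> point \<Rightarrow> point \<Rightarrow> bool" where
  "active_pair n S p q \<longleftrightarrow>
     {min (snd p) (snd q)..max (snd p) (snd q)} \<subseteq> active_time n S p \<inter> active_time n S q"

definition pred_pt :: "nat \<Rightarrow> update_list \<Rightarrow> point \<Rightarrow> point option" where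
  "pred_pt n S p =
     (let X = {x. x < fst p \<and> valid n S (x, snd p)}
      in if X = {} then None else Some (Max X, snd p))"

definition succ_pt :: "nat \<Rightarrow> update_list \<Rightarrow> point \<Rightarrow> point option" where
  "succ_pt n S p =
     (let X = {x. fst p < x \<and> valid n S (x, snd p)}
      in if X = {} then None else Some (Min X, snd p))"

definition rect :: "point \<Rightarrow> point \<Rightarrow> point set" where
  "rect p q = {min (fst p) (fst q)..max (fst p) (fst q)} \<times>
              {min (snd p) (snd q)..max (snd p) (snd q)}"


subsection \<open>Greedy\<close>

text \<open>In the following, \<open>Q\<close> is the set of points placed in the rows strictly below the
  current one.\<close>

definition stair :: "nat \<Rightarrow> update_list \<Rightarrow> point set \<Rightarrow> point \<Rightarrow> point set" where
  "stair n S Q u = {u} \<union> {q \<in> Q. active_pair n S u q \<and> rect u q \<inter> Q = {q}}"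

definition project :: "nat \<Rightarrow> point set \<Rightarrow> point set" where
  "project t Q = (\<lambda>q. (fst q, t)) ` Q"

text \<open>Row \<open>t\<close> is a relation rather than a function because ties are broken arbitrarily.\<close>

definition greedy_row :: "nat \<Rightarrow> update_list \<Rightarrow> point set \<Rightarrow> nat \<Rightarrow> point set \<Rightarrow> bool" where
  "greedy_row n S Q t R \<longleftrightarrow>
     (let p = (key_at S t, t) in
      if op_at S t = Access then R = project t (stair n S Q p)
      else
        (case (pred_pt n S p, succ_pt n S p) of
           (Some a, Some b) \<Rightarrow>
             (let L = project t (stair n S Q p \<union> stair n S Q a);
                  M = project t (stair n S Q p \<union> stair n S Q b)
              in R = L \<and> card L \<le> card M \<or> R = M \<and> card M \<le> card L)
         | _ \<Rightarrow> R = project t (stair n S Q p)))"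

text \<open>\<open>greedy_upto n S t P\<close>: some run of Greedy has placed exactly \<open>P\<close> after processing
  the times 1 to \<open>t\<close>.\<close>

inductive greedy_upto :: "nat \<Rightarrow> update_list \<Rightarrow> nat \<Rightarrow> point set \<Rightarrow> bool"
  for n :: nat and S :: update_list where
  start: "greedy_upto n S 0 {}"
| row: "greedy_upto n S t Q \<Longrightarrow> t < length S \<Longrightarrow> greedy_row n S Q (Suc t) R \<Longrightarrow>
        greedy_upto n S (Suc t) (Q \<union> R)"

definition greedy_output :: "nat \<Rightarrow> update_list \<Rightarrow> point set \<Rightarrow> bool" where
  "greedy_output n S P \<longleftrightarrow> greedy_upto n S (length S) P"

end

theory Submission
  imports Defs
begin

text \<open>
  Every update happens at an end of the deque, so Greedy never looks at a neighbour. An insertion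
  touches only its own key; a deletion touches the front and some of those keys \<open>x\<close> whose last
  touch time exceeds that of every live key in front of \<open>x\<close>.

  Split the live keys at a threshold \<open>c\<close> such that the keys above \<open>c\<close> have all been inserted at the
  back since \<open>c\<close> was chosen; once no live key is \<open>\<le> c\<close>, choose \<open>c\<close> to be the current maximum.
  If \<open>x < z\<close> are touched together, then \<open>z\<close> is not touched again while \<open>x\<close> is alive. So, between
  two choices of \<open>c\<close>, each key below \<open>c\<close> is, its deletion aside, only once followed in a row by
  another key below \<open>c\<close>, and each key above \<open>c\<close> is only once preceded in a row by another key above \<open>c\<close>. The potential
  below accounts for this, and gives \<open>card P \<le> 3 * m\<close>.
\<close>

section \<open>The potential of a deque with touch times\<close>

text \<open>If a deletion touches \<open>x\<close> and a larger \<open>z\<close> up to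
  \<open>c\<close>, then \<open>\<tau> x < \<tau> z\<close> held before, so \<open>x\<close> was
  dominated. Afterwards \<open>x\<close> carries the latest time and is not. Leaving this set pays
  for the touch.\<close>

definition dominated :: "'a::linorder \<Rightarrow> 'a set \<Rightarrow> ('a \<Rightarrow> nat) \<Rightarrow> 'a set" where
  "dominated c K \<tau> = {x \<in> K. x \<le> c \<and> (\<exists>z\<in>K. x < z \<and> z \<le> c \<and> \<tau> x < \<tau> z)}"

text \<open>Only records can be touched above \<open>c\<close>. Strictness matters: keys touched in
  one row tie, so only the smallest of those above \<open>c\<close> can remain a record.\<close>

definition records :: "'a::linorder \<Rightarrow> 'a set \<Rightarrow> ('a \<Rightarrow> nat) \<Rightarrow> 'a set" where
  "records c K \<tau> = {y \<in> K. c < y \<and> (\<forall>x\<in>K. c < x \<and> x < y \<longrightarrow> \<tau> x < \<tau> y)}"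

text \<open>The last summand prepays for the keys above \<open>c\<close> that a new choice of \<open>c\<close> puts below it.\<close>

definition potential :: "'a::linorder \<Rightarrow> 'a set \<Rightarrow> ('a \<Rightarrow> nat) \<Rightarrow> nat" where
  "potential c K \<tau> = card (dominated c K \<tau>) + card (records c K \<tau>) + card {y \<in> K. c < y}"

text \<open>This forces the front of a nonempty deque to be at most \<open>c\<close>. Deletions then
  never remove a key above \<open>c\<close>, which could turn other keys into records.\<close>

definition threshold_ok :: "'a::linorder \<Rightarrow> 'a set \<Rightarrow> bool" where
  "threshold_ok c K \<longleftrightarrow> K = {} \<or> (\<exists>x\<in>K. x \<le> c)"

lemma finite_dominated [simp]: "finite K \<Longrightarrow> finite (dominated c K \<tau>)"
  by (simp add: dominated_def)

lemma finite_records [simp]: "finite K \<Longrightarrow> finite (records c K \<tau>)"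
  by (simp add: records_def)

text \<open>In a nonempty deque the new front lies below \<open>c\<close>. It carries the latest
  time, so it is not dominated, and being the smallest key it dominates nothing. An empty deque
  restarts with \<open>c' = s\<close>.\<close>

lemma potential_push_front:
  fixes \<tau> :: "'a::linorder \<Rightarrow> nat"
  assumes "finite K" "\<forall>x\<in>K. s < x" "\<forall>x\<in>K. \<tau> x < t" "threshold_ok c K"
  shows "\<exists>c'. threshold_ok c' (insert s K) \<and> potential c' (insert s K) (\<tau>(s := t)) \<le> potential c K \<tau>"
proof (cases "K = {}")
  case True
  have e: "dominated s {s} (\<tau>(s := t)) = {}" "records s {s} (\<tau>(s := t)) = {}" "{y \<in> {s}. s < y} = {}"
    by (auto simp: dominated_def records_def)
  then have "potential s {s} (\<tau>(s := t)) = 0" by (simp only: potential_def card.empty)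
  then show ?thesis
    by (intro exI[of _ s]) (simp add: True threshold_ok_def)
next
  case False
  with assms(2,4) have sc: "s \<le> c" by (force simp: threshold_ok_def)
  have "dominated c (insert s K) (\<tau>(s := t)) \<subseteq> dominated c K \<tau>"
    using assms(2,3) by (force simp: dominated_def split: if_splits)
  moreover have "records c (insert s K) (\<tau>(s := t)) \<subseteq> records c K \<tau>"
  proof
    fix y assume "y \<in> records c (insert s K) (\<tau>(s := t))"
    then have "y \<in> insert s K" "c < y" "\<forall>x\<in>K. c < x \<and> x < y \<longrightarrow> (\<tau>(s := t)) x < (\<tau>(s := t)) y"
      by (auto simp only: records_def)
    moreover have "(\<tau>(s := t)) x = \<tau> x" if "c < x" for x using sc that by auto
    ultimately show "y \<in> records c K \<tau>" using sc unfolding records_def by fastforce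
  qed
  moreover have "{y \<in> insert s K. c < y} = {y \<in> K. c < y}" using sc by auto
  ultimately have "potential c (insert s K) (\<tau>(s := t)) \<le> potential c K \<tau>"
    unfolding potential_def using assms(1)
    by (intro add_le_mono card_mono) simp_all
  with sc show ?thesis by (auto simp: threshold_ok_def)
qed

text \<open>The two units pay for \<open>s\<close> as a possible new record and as a new key above
  the threshold.\<close>

lemma potential_push_back:
  fixes \<tau> :: "'a::linorder \<Rightarrow> nat"
  assumes "finite K" "K \<noteq> {}" "\<forall>x\<in>K. x < s" "threshold_ok c K"
  shows "\<exists>c'. threshold_ok c' (insert s K) \<and> potential c' (insert s K) (\<tau>(s := t)) \<le> potential c K \<tau> + 2"
proof -
  \<comment> \<open>The old \<open>c\<close> may exceed \<open>s\<close>; the freshly touched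
    \<open>s\<close> would then dominate every other key. Lowering the threshold to
    \<open>Max K\<close> puts \<open>s\<close> above it and splits \<open>K\<close> as
    before.\<close>
  define d where "d = min c (Max K)"
  have ds: "d < s" using assms by (auto simp: d_def min_less_iff_disj)
  have le: "x \<le> d \<longleftrightarrow> x \<le> c" if "x \<in> K" for x using that assms(1) by (auto simp: d_def)
  have lt: "d < x \<longleftrightarrow> c < x" if "x \<in> K" for x using le[OF that] by auto
  have "dominated d (insert s K) (\<tau>(s := t)) \<subseteq> dominated c K \<tau>"
    using ds le assms(3) by (fastforce simp: dominated_def split: if_splits)
  then have 1: "card (dominated d (insert s K) (\<tau>(s := t))) \<le> card (dominated c K \<tau>)"
    using assms(1) by (simp add: card_mono)
  have "records d (insert s K) (\<tau>(s := t)) \<subseteq> insert s (records c K \<tau>)"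
    using lt assms(3) by (fastforce simp: records_def split: if_splits)
  then have "card (records d (insert s K) (\<tau>(s := t))) \<le> card (insert s (records c K \<tau>))"
    using assms(1) by (simp add: card_mono)
  also have "\<dots> \<le> Suc (card (records c K \<tau>))" by (rule card_insert_le_m1) simp_all
  finally have 2: "card (records d (insert s K) (\<tau>(s := t))) \<le> Suc (card (records c K \<tau>))" .
  have "{y \<in> insert s K. d < y} \<subseteq> insert s {y \<in> K. c < y}" using lt by auto
  then have "card {y \<in> insert s K. d < y} \<le> card (insert s {y \<in> K. c < y})"
    using assms(1) by (intro card_mono) auto
  also have "\<dots> \<le> Suc (card {y \<in> K. c < y})" by (rule card_insert_le_m1) simp_all
  finally have 3: "card {y \<in> insert s K. d < y} \<le> Suc (card {y \<in> K. c < y})" .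
  have "threshold_ok d (insert s K)" using assms(2,4) le by (auto simp: threshold_ok_def)
  moreover have "potential d (insert s K) (\<tau>(s := t)) \<le> potential c K \<tau> + 2"
    using 1 2 3 by (simp add: potential_def)
  ultimately show ?thesis by blast
qed

text \<open>A touched key pays for itself by leaving \<open>dominated\<close> or
  \<open>records\<close>, with three possible exceptions: the front \<open>s\<close>, the largest
  other touched key up to \<open>c\<close>, and the smallest touched key above \<open>c\<close>.
  These account for the constant 3.\<close>

lemma potential_pop_front_same_threshold:
  fixes \<tau> :: "'a::linorder \<Rightarrow> nat"
  assumes fin: "finite K" and s: "s \<in> K" "\<forall>x\<in>K. s \<le> x" "s \<le> c"
    and T: "T \<subseteq> K" "\<forall>x\<in>T. \<forall>y\<in>K. y < x \<longrightarrow> \<tau> y < \<tau> x"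
    and t: "\<forall>x\<in>K. \<tau> x < t"
    and \<tau>': "\<tau>' = (\<lambda>x. if x \<in> T then t else \<tau> x)"
  shows "card T + potential c (K - {s}) \<tau>' \<le> potential c K \<tau> + 3"
proof -
  define A where "A = {x \<in> T - {s}. x \<le> c}"
  define B where "B = {x \<in> T. c < x}"
  have finT: "finite T" using fin T(1) finite_subset by blast
  have finA: "finite A" "finite B" using finT by (auto simp: A_def B_def)
  have "T \<subseteq> insert s (A \<union> B)" by (auto simp: A_def B_def)
  then have "card T \<le> card (insert s (A \<union> B))" using finA by (intro card_mono) auto
  also have "\<dots> \<le> Suc (card (A \<union> B))" by (rule card_insert_le_m1) simp_all
  also have "\<dots> \<le> Suc (card A + card B)" using card_Un_le by auto
  finally have cT: "card T \<le> Suc (card A + card B)" .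

  \<comment> \<open>No key becomes dominated. If the dominating \<open>z\<close> was touched, it was
    a record, hence already later than \<open>x\<close>; if not, \<open>x\<close> was not touched
    either, since its time would be \<open>t\<close>.\<close>
  have dsub: "dominated c (K - {s}) \<tau>' \<subseteq> dominated c K \<tau>"
  proof
    fix x assume "x \<in> dominated c (K - {s}) \<tau>'"
    then obtain z where z: "x \<in> K" "x \<le> c" "z \<in> K" "x < z" "z \<le> c" "\<tau>' x < \<tau>' z"
      by (auto simp: dominated_def)
    have "\<tau> x < \<tau> z"
    proof (cases "z \<in> T")
      case True then show ?thesis using T(2) z by blast
    next
      case False
      then show ?thesis using z t by (force simp: \<tau>' split: if_splits)
    qed
    with z show "x \<in> dominated c K \<tau>" by (auto simp: dominated_def)
  qed
  \<comment> \<open>Every key of \<open>A\<close> but the largest was dominated by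
    \<open>Max A\<close>; after the row, none of \<open>A\<close> is dominated.\<close>
  have A: "card A + card (dominated c (K - {s}) \<tau>') \<le> card (dominated c K \<tau>) + 1"
  proof (cases "A = {}")
    case True
    then show ?thesis using dsub fin by (simp add: card_mono le_SucI)
  next
    case False
    have M: "Max A \<in> A" using finA False by simp
    have "A - {Max A} \<subseteq> dominated c K \<tau>"
    proof
      fix x assume x: "x \<in> A - {Max A}"
      then have "x < Max A" using finA by (simp add: order_less_le)
      then show "x \<in> dominated c K \<tau>" using x M T by (auto simp: dominated_def A_def)
    qed
    moreover have "A \<inter> dominated c (K - {s}) \<tau>' = {}"
      using t by (fastforce simp: A_def dominated_def \<tau>' split: if_splits)
    ultimately have "card ((A - {Max A}) \<union> dominated c (K - {s}) \<tau>') \<le> card (dominated c K \<tau>)"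
      "card ((A - {Max A}) \<union> dominated c (K - {s}) \<tau>') = card (A - {Max A}) + card (dominated c (K - {s}) \<tau>')"
      using dsub fin finA by (auto intro!: card_mono card_Un_disjoint)
    then show ?thesis using M finA by (simp add: card_Diff_singleton)
  qed

  \<comment> \<open>No record arises: touched keys were records before, and an untouched record has
    no touched key between \<open>c\<close> and itself. As \<open>s\<close> is not above
    \<open>c\<close>, its removal changes no comparison.\<close>
  have rsub: "records c (K - {s}) \<tau>' \<subseteq> records c K \<tau>"
  proof
    fix y assume y: "y \<in> records c (K - {s}) \<tau>'"
    have "\<tau> x < \<tau> y" if x: "x \<in> K" "c < x" "x < y" for x
    proof (cases "y \<in> T")
      case True then show ?thesis using T(2) x by blast
    next
      case False
      have "x \<noteq> s" using x s(3) by auto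
      then have "\<tau>' x < \<tau>' y" using x y by (auto simp: records_def)
      then show ?thesis using False t x y by (force simp: \<tau>' records_def split: if_splits)
    qed
    with y show "y \<in> records c K \<tau>" by (auto simp: records_def)
  qed
  \<comment> \<open>All of \<open>B\<close> were records; after the row, every key but the smallest
    ties with \<open>Min B\<close> and stops being one.\<close>
  have B: "card B + card (records c (K - {s}) \<tau>') \<le> card (records c K \<tau>) + 1"
  proof (cases "B = {}")
    case True
    then show ?thesis using rsub fin by (simp add: card_mono le_SucI)
  next
    case False
    have M: "Min B \<in> B" using finA False by simp
    have "B \<subseteq> records c K \<tau>" using T by (auto simp: B_def records_def)
    moreover have "(B - {Min B}) \<inter> records c (K - {s}) \<tau>' = {}"
    proof -
      have "y \<notin> records c (K - {s}) \<tau>'" if y: "y \<in> B" "y \<noteq> Min B" for y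
      proof -
        have "Min B < y" using y finA by (simp add: order_less_le)
        moreover have "Min B \<in> K - {s}" "c < Min B" using M T(1) s(3) by (auto simp: B_def)
        moreover have "\<tau>' (Min B) = t" "\<tau>' y = t" using M y by (auto simp: B_def \<tau>')
        ultimately show ?thesis by (force simp: records_def)
      qed
      then show ?thesis by blast
    qed
    ultimately have "card ((B - {Min B}) \<union> records c (K - {s}) \<tau>') \<le> card (records c K \<tau>)"
      "card ((B - {Min B}) \<union> records c (K - {s}) \<tau>') = card (B - {Min B}) + card (records c (K - {s}) \<tau>')"
      using rsub fin finA by (auto intro!: card_mono card_Un_disjoint)
    then show ?thesis using M finA by (simp add: card_Diff_singleton)
  qed
  have "{y \<in> K - {s}. c < y} = {y \<in> K. c < y}" using s(3) by auto
  then show ?thesis using cT A B by (simp add: potential_def)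
qed

text \<open>When all live keys exceed \<open>c\<close>, the last summand of the potential equals
  \<open>card K\<close>. This covers every key that the choice \<open>Max K\<close> can make
  dominated, and that choice leaves no key above the threshold.\<close>

lemma potential_new_threshold:
  assumes "finite K"
  shows "\<exists>c'. threshold_ok c' K \<and> potential c' K \<tau> \<le> potential c K \<tau>"
proof (cases "threshold_ok c K")
  case False
  then have K: "K \<noteq> {}" "\<forall>x\<in>K. c < x" by (auto simp: threshold_ok_def not_le)
  let ?c = "Max K"
  have *: "records ?c K \<tau> = {}" "{y \<in> K. ?c < y} = {}"
    using assms by (auto simp: records_def leD)
  have "potential ?c K \<tau> = card (dominated ?c K \<tau>)" by (simp only: potential_def *) simp
  also have "\<dots> \<le> card {y \<in> K. c < y}"
    using K assms by (intro card_mono) (auto simp: dominated_def)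
  also have "\<dots> \<le> potential c K \<tau>" by (simp add: potential_def)
  finally show ?thesis using K assms by (intro exI[of _ ?c]) (auto simp: threshold_ok_def)
qed blast

lemma potential_pop_front:
  fixes \<tau> :: "'a::linorder \<Rightarrow> nat"
  assumes "finite K" "s \<in> K" "\<forall>x\<in>K. s \<le> x" "threshold_ok c K"
    and "T \<subseteq> K" "\<forall>x\<in>T. \<forall>y\<in>K. y < x \<longrightarrow> \<tau> y < \<tau> x" "\<forall>x\<in>K. \<tau> x < t"
  shows "\<exists>c'. threshold_ok c' (K - {s}) \<and>
           card T + potential c' (K - {s}) (\<lambda>x. if x \<in> T then t else \<tau> x) \<le> potential c K \<tau> + 3"
proof -
  have "s \<le> c" using assms(2-4) by (force simp: threshold_ok_def)
  then have "card T + potential c (K - {s}) (\<lambda>x. if x \<in> T then t else \<tau> x) \<le> potential c K \<tau> + 3"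
    using assms by (intro potential_pop_front_same_threshold) auto
  \<comment> \<open>Removing \<open>s\<close> may leave no key up to \<open>c\<close>, so the
    threshold is renewed only after the deletion.\<close>
  with potential_new_threshold[of "K - {s}" "\<lambda>x. if x \<in> T then t else \<tau> x" c] assms(1)
  show ?thesis by (meson add_left_mono finite_Diff le_trans)
qed

section \<open>Last touch times\<close>

text \<open>Rows start at 1, so the default 0 precedes every real touch, and untouched keys all
  tie.\<close>

definition last_touch :: "point set \<Rightarrow> nat \<Rightarrow> nat" where
  "last_touch Q x = Max (insert 0 {s. (x, s) \<in> Q})"

lemma finite_column: "finite Q \<Longrightarrow> finite {s. (x, s) \<in> Q}"
  by (rule finite_subset[of _ "snd ` Q"]) force+

lemma last_touch_ge: "finite Q \<Longrightarrow> (x, s) \<in> Q \<Longrightarrow> s \<le> last_touch Q x"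
  by (simp add: last_touch_def finite_column)

lemma last_touch_in: "finite Q \<Longrightarrow> last_touch Q x \<noteq> 0 \<Longrightarrow> (x, last_touch Q x) \<in> Q"
  using Max_in[of "insert 0 {s. (x, s) \<in> Q}"] by (auto simp: last_touch_def finite_column)

lemma last_touch_less:
  "finite Q \<Longrightarrow> \<forall>q\<in>Q. snd q < t \<Longrightarrow> 0 < t \<Longrightarrow> last_touch Q x < t"
  using last_touch_in[of Q x] by force

lemma last_touch_Un_row:
  assumes "finite Q" "\<forall>q\<in>Q. snd q < t" "finite T"
  shows "last_touch (Q \<union> T \<times> {t}) x = (if x \<in> T then t else last_touch Q x)"
proof (cases "x \<in> T")
  case True
  have "{s. (x, s) \<in> Q \<union> T \<times> {t}} = insert t {s. (x, s) \<in> Q}" using True by auto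
  moreover have "\<forall>s\<in>insert 0 {s. (x, s) \<in> Q}. s \<le> t" using assms(2) by fastforce
  ultimately show ?thesis using True assms(1)
    unfolding last_touch_def by (auto intro!: Max_eqI simp: finite_column)
next
  case False
  then have "{s. (x, s) \<in> Q \<union> T \<times> {t}} = {s. (x, s) \<in> Q}" by auto
  with False show ?thesis by (simp add: last_touch_def)
qed

section \<open>Live keys and valid points in a deque sequence\<close>

lemma keys_persist:
  assumes "a \<le> b" "\<forall>r. a < r \<and> r \<le> b \<longrightarrow> key_at S r \<noteq> x"
  shows "x \<in> keys n S b \<longleftrightarrow> x \<in> keys n S a"
  using assms
proof (induction b rule: dec_induct)
  case (step b)
  then have "x \<noteq> key_at S (Suc b)" by (metis le_imp_less_Suc order_refl)
  with step show ?case by (auto split: operation.split)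
qed simp

lemma active_pair_validD:
  assumes "active_pair n S p q" "min (snd p) (snd q) \<le> t" "t \<le> max (snd p) (snd q)"
  shows "valid n S (fst p, t)" "valid n S (fst q, t)"
proof -
  have t: "t \<in> active_time n S p" "t \<in> active_time n S q"
    using assms by (auto simp: active_pair_def)
  have "valid n S (fst u, t)" if "t \<in> active_time n S u" for u
    using that by (auto simp: active_time_def)
  with t show "valid n S (fst p, t)" "valid n S (fst q, t)" by blast+
qed

locale deque_run =
  fixes n :: nat and S :: update_list
  assumes ord: "output_restricted_deque_seq n S"
begin

lemma seq: "update_seq n S" and deque: "deque_seq n S"
  using ord by (auto simp: output_restricted_deque_seq_def deque_seq_def)

lemma key_range: "t \<in> {1..length S} \<Longrightarrow> key_at S t \<in> {1..n}"
  using seq by (simp add: update_seq_def)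

lemma not_access: "t \<in> {1..length S} \<Longrightarrow> op_at S t \<noteq> Access"
  using deque by (simp add: deque_seq_def)

lemma upd_pts_iff: "(x, t) \<in> upd_pts S \<longleftrightarrow> t \<in> {1..length S} \<and> key_at S t = x"
  using not_access[of t] by (cases "op_at S t") (auto simp: upd_pts_def pts_def)

lemma keys_subset: "t \<le> length S \<Longrightarrow> keys n S t \<subseteq> {1..n}"
proof (induction t)
  case (Suc t)
  then show ?case using key_range[of "Suc t"] by (auto split: operation.split)
qed auto

lemma finite_keys: "t \<le> length S \<Longrightarrow> finite (keys n S t)"
  using keys_subset finite_subset by blast

lemma previous_update_cases:
  obtains (none) "\<forall>r. 0 < r \<and> r < t \<longrightarrow> key_at S r \<noteq> x"
  | (some) r where "0 < r" "r < t" "key_at S r = x" "\<forall>r'. r < r' \<and> r' < t \<longrightarrow> key_at S r' \<noteq> x"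
proof (cases "\<exists>r. 0 < r \<and> r < t \<and> key_at S r = x")
  case True
  let ?R = "{r. 0 < r \<and> r < t \<and> key_at S r = x}"
  have fin: "finite ?R" by simp
  then have "Max ?R \<in> ?R" using True by (intro Max_in) auto
  moreover have "\<forall>r'. Max ?R < r' \<and> r' < t \<longrightarrow> key_at S r' \<noteq> x"
    using fin by (metis (mono_tags, lifting) Max_ge mem_Collect_eq not_le gr0I not_less0)
  ultimately show ?thesis using some by blast
qed (use none in blast)

lemma alternate:
  assumes "0 < r" "r < t" "t \<le> length S" "key_at S r = key_at S t"
    and "\<forall>r'. r < r' \<and> r' < t \<longrightarrow> key_at S r' \<noteq> key_at S t"
  shows "op_at S r \<noteq> op_at S t"
proof -
  have "alternating S" using seq by (simp add: update_seq_def)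
  moreover have "(key_at S t, r) \<in> upd_pts S" "(key_at S t, t) \<in> upd_pts S"
    using assms by (auto simp: upd_pts_iff)
  ultimately show ?thesis using assms by (auto simp: alternating_def upd_pts_iff)
qed

text \<open>Alternation makes the previous update of the key the opposite one, and membership has
  not changed since. Without a previous update, the definition of the initial set decides.\<close>

lemma key_before_update:
  assumes "Suc t \<le> length S"
  shows "key_at S (Suc t) \<in> keys n S t \<longleftrightarrow> op_at S (Suc t) \<noteq> Insert"
proof (cases rule: previous_update_cases[where t = "Suc t" and x = "key_at S (Suc t)", case_names none some])
  case none
  have "key_at S (Suc t) \<in> keys n S t \<longleftrightarrow> key_at S (Suc t) \<in> keys n S 0"
    using none by (intro keys_persist) auto
  also have "\<dots> \<longleftrightarrow> op_at S (Suc t) \<noteq> Insert"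
  proof
    assume "key_at S (Suc t) \<in> keys n S 0"
    then obtain r where r: "r \<in> {1..length S}" "key_at S r = key_at S (Suc t)" "op_at S r \<noteq> Insert"
      "\<forall>s\<in>{1..<r}. key_at S s \<noteq> key_at S (Suc t)" by auto
    \<comment> \<open>Both \<open>r\<close> and \<open>Suc t\<close> are the first occurrence of the
      key, so they coincide.\<close>
    have "\<not> r < Suc t" using none r by auto
    moreover have "\<not> Suc t < r" using r(4) by auto
    ultimately show "op_at S (Suc t) \<noteq> Insert" using r(3) by (metis linorder_neqE_nat)
  next
    assume "op_at S (Suc t) \<noteq> Insert"
    then show "key_at S (Suc t) \<in> keys n S 0"
      using none assms key_range[of "Suc t"] by (auto intro!: bexI[of _ "Suc t"])
  qed
  finally show ?thesis .
next
  case (some r)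
  have "op_at S r \<noteq> op_at S (Suc t)" by (rule alternate) (use some assms in auto)
  moreover have "key_at S (Suc t) \<in> keys n S t \<longleftrightarrow> key_at S (Suc t) \<in> keys n S r"
    using some by (intro keys_persist) auto
  moreover have "key_at S (Suc t) \<in> keys n S r \<longleftrightarrow> op_at S r = Insert"
    using some not_access[of r] assms by (cases r) (auto split: operation.split)
  moreover have "op_at S (Suc t) \<noteq> Access" "op_at S r \<noteq> Access"
    using not_access some assms by auto
  ultimately show ?thesis by (cases "op_at S r"; cases "op_at S (Suc t)") auto
qed

text \<open>If row \<open>t\<close> does not update the key, its point there is no update point and
  the next update is an insertion, whereas validity of such a point demands a deletion.\<close>

lemma valid_not_before_insert:
  assumes "Suc t \<le> length S" "op_at S (Suc t) = Insert" "valid n S (key_at S (Suc t), t)"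
  shows "key_at S t = key_at S (Suc t)"
proof (rule ccontr)
  assume ne: "key_at S t \<noteq> key_at S (Suc t)"
  let ?x = "key_at S (Suc t)"
  let ?R = "{r. (?x, r) \<in> upd_pts S \<and> t < r}"
  have "(?x, t) \<notin> upd_pts S" using ne by (simp add: upd_pts_iff)
  then have "none_or_in (next_upd S (?x, t)) (pts S Delete)"
    using assms(3) by (auto simp: valid_def upd_pts_def)
  moreover have mem: "Suc t \<in> ?R" using assms(1) by (simp add: upd_pts_iff)
  moreover have "Min ?R = Suc t"
    by (rule Min_eqI) (use mem in \<open>auto intro: finite_subset[of _ "{..length S}"] simp: upd_pts_iff\<close>)
  ultimately have "(?x, Suc t) \<in> pts S Delete"
    by (auto simp: none_or_in_def next_upd_def Let_def split: if_splits)
  with assms(2) show False by (simp add: pts_def)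
qed

text \<open>Off the updated key, validity says that the previous update is an insertion or missing.
  If it is missing, the next update is the first one and is a deletion, so the key was live from the
  start.\<close>

lemma valid_imp_key:
  assumes "Suc t \<le> length S" "valid n S (x, Suc t)" "x \<noteq> key_at S (Suc t)"
  shows "x \<in> keys n S t"
proof -
  have notU: "(x, Suc t) \<notin> upd_pts S" using assms(3) by (simp add: upd_pts_iff)
  then have prev: "none_or_in (prev_upd S (x, Suc t)) (pts S Insert)"
    and nxt: "none_or_in (next_upd S (x, Suc t)) (pts S Delete)" and xn: "x \<in> {1..n}"
    using assms(2) by (auto simp: valid_def upd_pts_def)
  show ?thesis
  proof (cases rule: previous_update_cases[where t = "Suc t" and x = x, case_names none some])
    case none
    let ?R = "{r. (x, r) \<in> upd_pts S \<and> Suc t < r}"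
    \<comment> \<open>Every key occurs in \<open>S\<close>; as \<open>x\<close> does not occur up to
      \<open>Suc t\<close>, a later update exists.\<close>
    obtain r where r: "r \<in> {1..length S}" "key_at S r = x"
      using seq xn unfolding update_seq_def by blast
    then have "Suc t < r" using none assms(3) by (metis Suc_lessI Suc_le_eq atLeastAtMost_iff
          less_Suc_eq linorder_neqE_nat One_nat_def)
    then have ne: "?R \<noteq> {}" using r by (auto simp: upd_pts_iff)
    have fin: "finite ?R" by (rule finite_subset[of _ "{..length S}"]) (auto simp: upd_pts_iff)
    have m: "Min ?R \<in> ?R" using fin ne by (rule Min_in)
    have "(x, Min ?R) \<in> pts S Delete"
      using nxt ne by (auto simp: none_or_in_def next_upd_def Let_def split: if_splits)
    then have del: "op_at S (Min ?R) \<noteq> Insert" by (auto simp: pts_def)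
    have first: "key_at S s \<noteq> x" if s: "s \<in> {1..<Min ?R}" for s
    proof
      assume k: "key_at S s = x"
      then have "Suc t < s" using none s assms(3) by (metis Suc_lessI Suc_le_eq atLeastLessThan_iff
          less_Suc_eq linorder_neqE_nat One_nat_def)
      moreover have "s \<le> length S" using s m by (auto simp: upd_pts_iff)
      ultimately have "s \<in> ?R" using k s by (auto simp: upd_pts_iff)
      then have "Min ?R \<le> s" using fin by simp
      with s show False by auto
    qed
    have "Min ?R \<in> {1..length S}" "key_at S (Min ?R) = x"
      using m unfolding mem_Collect_eq upd_pts_iff by blast+
    then have "x \<in> keys n S 0"
      using xn del first unfolding keys.simps(1) by blast
    moreover have "x \<in> keys n S t \<longleftrightarrow> x \<in> keys n S 0"
      using none by (intro keys_persist) auto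
    ultimately show ?thesis by blast
  next
    case (some r)
    let ?R = "{r. (x, r) \<in> upd_pts S \<and> r < Suc t}"
    have mem: "r \<in> ?R" using some assms(1) by (auto simp: upd_pts_iff)
    moreover have "Max ?R = r"
    proof (rule Max_eqI)
      show "y \<le> r" if "y \<in> ?R" for y
        using that some(4) unfolding mem_Collect_eq upd_pts_iff by (metis not_le)
    qed (use mem in simp_all)
    ultimately have "(x, r) \<in> pts S Insert"
      using prev by (auto simp: none_or_in_def prev_upd_def Let_def split: if_splits)
    then have "op_at S r = Insert" by (auto simp: pts_def)
    then have "x \<in> keys n S r" using some by (cases r) auto
    moreover have "x \<in> keys n S t \<longleftrightarrow> x \<in> keys n S r"
      using some by (intro keys_persist) auto
    ultimately show ?thesis by blast
  qed
qed

text \<open>The deque condition speaks of the keys after the insertion; since the key was absent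
  before, the comparison with the old keys is strict.\<close>

lemma insert_extreme:
  assumes "Suc t \<le> length S" "op_at S (Suc t) = Insert"
  shows "(\<forall>x\<in>keys n S t. key_at S (Suc t) < x) \<or> (\<forall>x\<in>keys n S t. x < key_at S (Suc t))"
proof -
  let ?s = "key_at S (Suc t)" and ?K = "keys n S t"
  have fin: "finite (keys n S (Suc t))" using finite_keys assms(1) by blast
  have K: "keys n S (Suc t) = insert ?s ?K" using assms(2) by simp
  have "?s \<notin> ?K" using key_before_update[OF assms(1)] assms(2) by simp
  moreover have "?s = Min (insert ?s ?K) \<or> ?s = Max (insert ?s ?K)"
    using deque assms K unfolding deque_seq_def by (metis Suc_eq_plus1 atLeastAtMost_iff le_add2)
  then have "(\<forall>x\<in>?K. ?s \<le> x) \<or> (\<forall>x\<in>?K. x \<le> ?s)"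
    using fin unfolding K by (metis Max_ge Min_le insertCI)
  ultimately show ?thesis by (metis order_less_le)
qed

lemma delete_front:
  assumes "Suc t \<le> length S" "op_at S (Suc t) = Delete"
  shows "key_at S (Suc t) \<in> keys n S t" "x \<in> keys n S t \<Longrightarrow> key_at S (Suc t) \<le> x"
proof -
  show "key_at S (Suc t) \<in> keys n S t" using key_before_update[OF assms(1)] assms(2) by simp
  have "key_at S (Suc t) = Min (keys n S t)"
    using ord assms unfolding output_restricted_deque_seq_def
    by (metis Suc_eq_plus1 atLeastAtMost_iff diff_add_inverse2 le_add2)
  then show "x \<in> keys n S t \<Longrightarrow> key_at S (Suc t) \<le> x"
    using finite_keys[of t] assms(1) by simp
qed

section \<open>The rows placed by Greedy\<close>

text \<open>Other valid points of the row belong to live keys, and the updated key lies at an end of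
  these. Hence Greedy always takes the stair of the updated point alone.\<close>

lemma no_pred_or_no_succ:
  assumes "Suc t \<le> length S"
  shows "pred_pt n S (key_at S (Suc t), Suc t) = None \<or> succ_pt n S (key_at S (Suc t), Suc t) = None"
proof -
  let ?s = "key_at S (Suc t)" and ?K = "keys n S t"
  have "(\<forall>x\<in>?K. ?s \<le> x) \<or> (\<forall>x\<in>?K. x \<le> ?s)"
  proof (cases "op_at S (Suc t)")
    case Insert
    then show ?thesis using insert_extreme[OF assms] by (auto intro: less_imp_le)
  qed (use not_access[of "Suc t"] delete_front assms in auto)
  then show ?thesis
  proof
    assume "\<forall>x\<in>?K. ?s \<le> x"
    then have "\<not> valid n S (x, Suc t)" if "x < ?s" for x
      using valid_imp_key[OF assms, of x] that by force
    then have "{x. x < ?s \<and> valid n S (x, Suc t)} = {}" by blast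
    then show ?thesis by (simp add: pred_pt_def)
  next
    assume "\<forall>x\<in>?K. x \<le> ?s"
    then have "\<not> valid n S (x, Suc t)" if "?s < x" for x
      using valid_imp_key[OF assms, of x] that by force
    then have "{x. ?s < x \<and> valid n S (x, Suc t)} = {}" by blast
    then show ?thesis by (simp add: succ_pt_def)
  qed
qed

lemma greedy_row_eq_stair:
  assumes "Suc t \<le> length S" "greedy_row n S Q (Suc t) R"
  shows "R = project (Suc t) (stair n S Q (key_at S (Suc t), Suc t))"
  using no_pred_or_no_succ[OF assms(1)]
proof
  have op: "op_at S (Suc t) \<noteq> Access" using not_access assms(1) by simp
  {
    assume "pred_pt n S (key_at S (Suc t), Suc t) = None"
    with op assms(2) show ?thesis by (simp add: greedy_row_def Let_def)
  next
    assume "succ_pt n S (key_at S (Suc t), Suc t) = None"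
    with op assms(2) show ?thesis
      by (cases "pred_pt n S (key_at S (Suc t), Suc t)") (simp_all add: greedy_row_def Let_def)
  }
qed

text \<open>A key that was deleted just before its reinsertion has an active time containing both
  operations; its own point in the preceding row then hides everything else.\<close>

lemma insert_touches_only_itself:
  assumes t: "Suc t \<le> length S" "op_at S (Suc t) = Insert"
    and Q: "\<forall>q\<in>Q. 1 \<le> snd q \<and> snd q \<le> t" "\<forall>r\<in>{1..t}. (key_at S r, r) \<in> Q"
    and q: "q \<in> stair n S Q (key_at S (Suc t), Suc t)"
  shows "fst q = key_at S (Suc t)"
proof (cases "q \<in> Q")
  case True
  let ?u = "(key_at S (Suc t), Suc t)"
  have qt: "1 \<le> snd q" "snd q \<le> t" using Q True by auto
  then have act: "active_pair n S ?u q" and rect: "rect ?u q \<inter> Q = {q}"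
    using q by (auto simp: stair_def)
  have "valid n S (key_at S (Suc t), t)"
    using active_pair_validD(1)[OF act, of t] qt by simp
  then have "key_at S t = key_at S (Suc t)" using valid_not_before_insert t by blast
  then have "(key_at S (Suc t), t) \<in> Q" using Q(2) qt
    by (metis atLeastAtMost_iff order_refl order_trans)
  moreover have "(key_at S (Suc t), t) \<in> rect ?u q" using qt by (auto simp: rect_def)
  ultimately have "(key_at S (Suc t), t) = q" using rect by blast
  then show ?thesis by auto
qed (use q in \<open>auto simp: stair_def\<close>)

text \<open>The deleted key is the front, so every live \<open>y < fst q\<close> lies horizontally
  between it and \<open>q\<close>. A touch of \<open>y\<close> no earlier than \<open>q\<close>
  would be a second point in the rectangle, which is empty but for \<open>q\<close>.\<close>

lemma delete_touches_records:
  assumes t: "Suc t \<le> length S" "op_at S (Suc t) = Delete"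
    and Q: "finite Q" "\<forall>q\<in>Q. 1 \<le> snd q \<and> snd q \<le> t"
    and q: "q \<in> stair n S Q (key_at S (Suc t), Suc t)" "fst q \<noteq> key_at S (Suc t)"
  shows "fst q \<in> keys n S t"
    and "y \<in> keys n S t \<Longrightarrow> y < fst q \<Longrightarrow> last_touch Q y < last_touch Q (fst q)"
proof -
  let ?u = "(key_at S (Suc t), Suc t)"
  have act: "active_pair n S ?u q" and rect: "rect ?u q \<inter> Q = {q}" and qQ: "q \<in> Q"
    using q by (auto simp: stair_def)
  have qt: "1 \<le> snd q" "snd q \<le> t" using Q(2) qQ by auto
  have "valid n S (fst q, Suc t)"
    using active_pair_validD(2)[OF act, of "Suc t"] qt by simp
  then show key: "fst q \<in> keys n S t" using valid_imp_key t(1) q(2) by blast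
  assume y: "y \<in> keys n S t" "y < fst q"
  have sy: "key_at S (Suc t) \<le> y" using delete_front(2)[OF t y(1)] .
  have "last_touch Q y < snd q"
  proof (rule ccontr)
    assume ge: "\<not> last_touch Q y < snd q"
    \<comment> \<open>Since \<open>snd q\<close> is at least 1, the last touch of \<open>y\<close>
      is not the default 0 and is a genuine point of \<open>Q\<close>.\<close>
    then have "(y, last_touch Q y) \<in> Q" using qt Q(1) by (intro last_touch_in) auto
    moreover from this have "last_touch Q y \<le> t" using Q(2) by auto
    then have "(y, last_touch Q y) \<in> rect ?u q" using ge sy y(2) qt by (auto simp: rect_def)
    ultimately have "(y, last_touch Q y) = q" using rect by blast
    with y(2) show False by auto
  qed
  also have "snd q \<le> last_touch Q (fst q)" using last_touch_ge[OF Q(1)] qQ by (metis prod.collapse)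
  finally show "last_touch Q y < last_touch Q (fst q)" .
qed

section \<open>The amortized invariant\<close>

text \<open>The presence of all updated points is carried along because the insertion case needs the
  point of the preceding row as a blocker.\<close>

definition amortized :: "nat \<Rightarrow> point set \<Rightarrow> bool" where
  "amortized t Q \<longleftrightarrow>
     finite Q \<and> (\<forall>q\<in>Q. 1 \<le> snd q \<and> snd q \<le> t) \<and> (\<forall>r\<in>{1..t}. (key_at S r, r) \<in> Q) \<and>
     (\<exists>c. threshold_ok c (keys n S t) \<and> card Q + potential c (keys n S t) (last_touch Q) \<le> 3 * t)"

text \<open>With all touch times 0 nothing is dominated, and no key exceeds \<open>Max ?K\<close>.
  If \<open>?K\<close> is empty, \<open>Max ?K\<close> is unspecified, but the potential is 0 for
  any threshold.\<close>

lemma amortized_start: "amortized 0 {}"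
proof -
  let ?K = "keys n S 0"
  have fin: "finite ?K" by simp
  have "last_touch {} = (\<lambda>_. 0)" by (simp add: last_touch_def fun_eq_iff)
  moreover have "dominated (Max ?K) ?K (\<lambda>_. 0) = {}" by (simp add: dominated_def)
  moreover have "records (Max ?K) ?K (\<lambda>_. 0) = {}" "{y \<in> ?K. Max ?K < y} = {}"
    using fin by (auto simp: records_def leD simp del: keys.simps)
  ultimately have "potential (Max ?K) ?K (last_touch {}) = 0"
    unfolding potential_def by (simp only: card.empty)
  moreover have "threshold_ok (Max ?K) ?K"
    unfolding threshold_ok_def using fin Max_in by blast
  ultimately show ?thesis unfolding amortized_def by fastforce
qed

lemma amortized_step:
  assumes am: "amortized t Q" and t: "Suc t \<le> length S" and row: "greedy_row n S Q (Suc t) R"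
  shows "amortized (Suc t) (Q \<union> R)"
proof -
  let ?s = "key_at S (Suc t)" and ?K = "keys n S t"
  define st where "st = stair n S Q (?s, Suc t)"
  define T where "T = fst ` st"
  from am obtain c where Q: "finite Q" "\<forall>q\<in>Q. 1 \<le> snd q \<and> snd q \<le> t" "\<forall>r\<in>{1..t}. (key_at S r, r) \<in> Q"
    and c: "threshold_ok c ?K" "card Q + potential c ?K (last_touch Q) \<le> 3 * t"
    by (auto simp: amortized_def)
  have R: "R = T \<times> {Suc t}"
    using greedy_row_eq_stair[OF t row] by (auto simp: project_def T_def st_def)
  have "finite st" using Q(1) by (simp add: st_def stair_def)
  then have finT: "finite T" by (simp add: T_def)
  have sT: "?s \<in> T" by (force simp: T_def st_def stair_def)
  have Qlt: "\<forall>q\<in>Q. snd q < Suc t" using Q(2) by auto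
  have lt: "\<forall>x\<in>?K. last_touch Q x < Suc t" using last_touch_less[OF Q(1) Qlt] by simp
  have touch: "last_touch (Q \<union> R) = (\<lambda>x. if x \<in> T then Suc t else last_touch Q x)"
    using last_touch_Un_row[OF Q(1) Qlt finT] unfolding R by (simp add: fun_eq_iff)
  have card: "card (Q \<union> R) \<le> card Q + card T"
    using card_Un_le[of Q R] by (simp add: R card_cartesian_product)
  have finK: "finite ?K" using finite_keys t by simp
  \<comment> \<open>Each operation has a budget of 3. An insertion spends one unit on its touch and
    at most two on the potential; a deletion is covered by
    \<open>potential_pop_front\<close>.\<close>
  have "\<exists>c'. threshold_ok c' (keys n S (Suc t)) \<and>
    card T + potential c' (keys n S (Suc t)) (last_touch (Q \<union> R)) \<le> potential c ?K (last_touch Q) + 3"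
  proof (cases "op_at S (Suc t)")
    case Insert
    have T: "T = {?s}"
      using insert_touches_only_itself[OF t Insert Q(2,3)] sT by (auto simp: T_def st_def)
    have upd: "last_touch (Q \<union> R) = (last_touch Q)(?s := Suc t)"
      by (simp add: touch T fun_eq_iff)
    have K': "keys n S (Suc t) = insert ?s ?K" using Insert by simp
    \<comment> \<open>An empty deque falls under the first case vacuously.\<close>
    consider "\<forall>x\<in>?K. ?s < x" | "?K \<noteq> {}" "\<forall>x\<in>?K. x < ?s"
      using insert_extreme[OF t Insert] by blast
    then have "\<exists>c'. threshold_ok c' (insert ?s ?K) \<and>
      potential c' (insert ?s ?K) ((last_touch Q)(?s := Suc t)) \<le> potential c ?K (last_touch Q) + 2"
    proof cases
      case 1
      from potential_push_front[OF finK 1 lt c(1)] show ?thesis using trans_le_add1 by blast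
    next
      case 2
      from potential_push_back[OF finK 2 c(1)] show ?thesis .
    qed
    then show ?thesis unfolding upd K' by (auto simp: T)
  next
    case Delete
    have K': "keys n S (Suc t) = ?K - {?s}" using Delete by simp
    have sK: "?s \<in> ?K" "\<forall>x\<in>?K. ?s \<le> x" using delete_front[OF t Delete] by auto
    \<comment> \<open>The front key meets the record condition vacuously, having no live key before
      it.\<close>
    have rec: "x \<in> ?K \<and> (\<forall>y\<in>?K. y < x \<longrightarrow> last_touch Q y < last_touch Q x)" if x: "x \<in> T" for x
    proof (cases "x = ?s")
      case True
      then show ?thesis using sK leD by blast
    next
      case False
      then show ?thesis using x delete_touches_records[OF t Delete Q(1,2)]
        by (auto simp: T_def st_def)
    qed
    show ?thesis unfolding K' touch
      by (rule potential_pop_front[OF finK sK c(1)]) (use rec lt in auto)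
  next
    case Access
    then show ?thesis using not_access[of "Suc t"] t by simp
  qed
  then obtain c' where "threshold_ok c' (keys n S (Suc t))"
    "card (Q \<union> R) + potential c' (keys n S (Suc t)) (last_touch (Q \<union> R)) \<le> 3 * Suc t"
    using c(2) card by fastforce
  moreover have "finite (Q \<union> R)" "\<forall>q\<in>Q \<union> R. 1 \<le> snd q \<and> snd q \<le> Suc t"
    using Q finT by (auto simp: R)
  moreover have "\<forall>r\<in>{1..Suc t}. (key_at S r, r) \<in> Q \<union> R"
    using Q(3) sT by (auto simp: R le_Suc_eq)
  ultimately show ?thesis unfolding amortized_def by blast
qed

lemma greedy_upto_amortized: "greedy_upto n S t Q \<Longrightarrow> amortized t Q"
  by (induction rule: greedy_upto.induct) (auto intro: amortized_start amortized_step)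

end

theorem theorem25:
  fixes n m :: nat and S :: "(nat \<times> operation) list" and P :: "(nat \<times> nat) set"
  assumes "n \<ge> 1" and "m \<ge> 1"
    and "length S = m"
    and "output_restricted_deque_seq n S"
    and "greedy_output n S P"
  shows "finite P \<and> card P \<le> 24 * m + 12 * n"
proof -
  interpret deque_run n S using assms(4) by unfold_locales
  have "amortized m P"
    using greedy_upto_amortized assms(3,5) by (auto simp: greedy_output_def)
  then show ?thesis by (auto simp: amortized_def)
qed

end
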